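(* Let $A, B \in M_4(\mathbb{C})$ satisfy $\operatorname{Tr}(A) = \operatorname{Tr}(B) = 0$ and $\|A\|_F^2 + \|B\|_F^2 = \frac{1}{4}$. Suppose that each of $A$ and $B$ is unitarily equivalent to a block-diagonal matrix with two $2\times 2$ diagonal blocks, i.e. there exist unitary $U, V \in M_4(\mathbb{C})$ and $A_{11}, A_{22}, B_{11}, B_{22} \in M_2(\mathbb{C})$ such that $UAU^* = \begin{bmatrix} A_{11} & 0 \\ 0 & A_{22}\end{bmatrix}$ and $VBV^* = \begin{bmatrix} B_{11} & 0 \\ 0 & B_{22}\end{bmatrix}$. Let $X = A \otimes I_4 + I_4 \otimes B \in M_{16}(\mathbb{C})$. Then $$\sigma_1(X)^2 + \sigma_2(X)^2 \leq \frac{1}{2},$$ where $\sigma_1(X) \ge \sigma_2(X)$ are the largest and second-largest singular values of $X$.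
   Context: $\|\cdot\|_F$ denotes the Frobenius norm, $\|A\|_F = (\operatorname{Tr}(A^*A))^{1/2}$. $\otimes$ denotes the Kronecker product. "Unitarily equivalent" is used in the sense $A \mapsto UAU^*$ with $U$ unitary. *)

theory Defs
  imports "Jordan_Normal_Form.Schur_Decomposition" "Jordan_Normal_Form.Char_Poly"
begin

definition mtrace :: "complex mat \<Rightarrow> complex" where
  "mtrace A = (\<Sum>i<dim_row A. A $$ (i,i))"

definition fro_norm :: "complex mat \<Rightarrow> real" where
  "fro_norm A = sqrt (Re (mtrace (mat_adjoint A * A)))"

definition unitary_mat :: "nat \<Rightarrow> complex mat \<Rightarrow> bool" where
  "unitary_mat n U \<longleftrightarrow> U \<in> carrier_mat n n \<and>
     mat_adjoint U * U = 1\<^sub>m n \<and> U * mat_adjoint U = 1\<^sub>m n"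

definition kron :: "complex mat \<Rightarrow> complex mat \<Rightarrow> complex mat" where
  "kron A B = mat (dim_row A * dim_row B) (dim_col A * dim_col B)
     (\<lambda>(i,j). A $$ (i div dim_row B, j div dim_col B) * B $$ (i mod dim_row B, j mod dim_col B))"

definition singular_values :: "complex mat \<Rightarrow> real list" where
  "singular_values X = rev (sorted_list_of_multiset
     (image_mset (\<lambda>z. sqrt (Re z)) (proots (char_poly (mat_adjoint X * X)))))"

definition sigma :: "nat \<Rightarrow> complex mat \<Rightarrow> real" where
  "sigma k X = singular_values X ! (k - 1)"

end

theory Submission
  imports Defs
begin

text \<open>
  Write \<open>A = A\<^sub>1 \<oplus> A\<^sub>2\<close> and \<open>B = B\<^sub>1 \<oplus> B\<^sub>2\<close> after unitary changes of basis. Then \<open>X\<close> is unitarily equivalent to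
  the direct sum of the four matrices \<open>M\<^sub>i\<^sub>j = A\<^sub>i \<otimes> I + I \<otimes> B\<^sub>j\<close>, and its two largest singular values come from
  these blocks; note that \<open>tr A\<^sub>2 = - tr A\<^sub>1\<close> and \<open>tr B\<^sub>2 = - tr B\<^sub>1\<close>.
  If both lie in one block, their squares add up to at most \<open>\<parallel>M\<^sub>i\<^sub>j\<parallel>\<^sub>F\<^sup>2\<close>. If the blocks differ in
  both indices, \<open>\<parallel>M\<^sub>i\<^sub>j\<parallel>\<^sup>2 \<le> 2\<parallel>A\<^sub>i\<parallel>\<^sub>F\<^sup>2 + 2\<parallel>B\<^sub>j\<parallel>\<^sub>F\<^sup>2\<close> suffices. If they share \<open>A\<^sub>i\<close>, one uses the sharper
  \<open>\<parallel>M\<^sub>i\<^sub>j\<parallel>\<^sup>2 \<le> 4\<bar>c\<bar>\<^sup>2 + \<parallel>P\<parallel>\<^sub>F\<^sup>2 + 2\<parallel>Q\<parallel>\<^sub>F\<^sup>2\<close>, where \<open>P\<close>, \<open>Q\<close> are the traceless parts of \<open>A\<^sub>i\<close>, \<open>B\<^sub>j\<close> and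
  \<open>M\<^sub>i\<^sub>j = c I + P \<otimes> I + I \<otimes> Q\<close>. Regarding vectors as two-by-two matrices, a singular value
  decomposition \<open>diag(s, t)\<close> of the vector makes this Cauchy-Schwarz with \<open>1/4 + 1/2 + 1/4 = 1\<close>;
  below, the decomposition is replaced by a polynomial identity.
\<close>

section \<open>Norm bounds for the map taking Y to A Y + Y B^T on two-by-two matrices\<close>

lemma two_Re_mult_cnj_le: "2 * Re (u * cnj v) \<le> (cmod u)\<^sup>2 + (cmod v)\<^sup>2"
proof -
  have "0 \<le> (Re u - Re v)\<^sup>2 + (Im u - Im v)\<^sup>2" by simp
  then show ?thesis unfolding cmod_power2 by (simp add: power2_eq_square algebra_simps)
qed

lemma cmod_add_power2_le: "(cmod (u + v))\<^sup>2 \<le> 2 * (cmod u)\<^sup>2 + 2 * (cmod v)\<^sup>2"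
proof -
  have "0 \<le> (cmod (u - v))\<^sup>2" by simp
  then show ?thesis unfolding cmod_power2 by (simp add: power2_eq_square algebra_simps)
qed

text \<open>Lagrange's identity: the defect in this Cauchy-Schwarz inequality is itself a squared
  modulus.\<close>

lemma cmod_inner2_power2_le:
  "(cmod (a * x + b * y))\<^sup>2 \<le> ((cmod a)\<^sup>2 + (cmod b)\<^sup>2) * ((cmod x)\<^sup>2 + (cmod y)\<^sup>2)"
proof -
  have "((cmod a)\<^sup>2 + (cmod b)\<^sup>2) * ((cmod x)\<^sup>2 + (cmod y)\<^sup>2) - (cmod (a * x + b * y))\<^sup>2
    = (cmod (a * cnj y - b * cnj x))\<^sup>2"
    unfolding cmod_power2 by (simp add: power2_eq_square algebra_simps)
  then show ?thesis by (metis diff_ge_0_iff_ge zero_le_power2)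
qed

text \<open>
  For two-by-two matrices \<open>Y\<close>, \<open>Z\<close> the \<open>g\<close> are the entries of \<open>Z Y\<^sup>*\<close>, the \<open>h\<close> those of the transpose of
  \<open>Y\<^sup>* Z\<close>, and the last bracket is \<open>\<parallel>Z adj(Y)\<parallel>\<^sup>2 + \<bar>tr (Z adj(Y))\<bar>\<^sup>2\<close> with the adjugate \<open>adj(Y)\<close>.
\<close>

lemma sylvester_2_dual_identity:
  fixes y11 y12 y21 y22 z11 z12 z21 z22 :: complex
  defines "n \<equiv> (cmod y11)\<^sup>2 + (cmod y12)\<^sup>2 + (cmod y21)\<^sup>2 + (cmod y22)\<^sup>2"
    and "g11 \<equiv> z11 * cnj y11 + z12 * cnj y12" and "g12 \<equiv> z11 * cnj y21 + z12 * cnj y22"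
    and "g21 \<equiv> z21 * cnj y11 + z22 * cnj y12" and "g22 \<equiv> z21 * cnj y21 + z22 * cnj y22"
    and "h11 \<equiv> z11 * cnj y11 + z21 * cnj y21" and "h12 \<equiv> z11 * cnj y12 + z21 * cnj y22"
    and "h21 \<equiv> z12 * cnj y11 + z22 * cnj y21" and "h22 \<equiv> z12 * cnj y12 + z22 * cnj y22"
  shows "n * ((cmod z11)\<^sup>2 + (cmod z12)\<^sup>2 + (cmod z21)\<^sup>2 + (cmod z22)\<^sup>2)
    = ((cmod g11)\<^sup>2 + (cmod g12)\<^sup>2 + (cmod g21)\<^sup>2 + (cmod g22)\<^sup>2)
      + ((cmod h11)\<^sup>2 + (cmod h12)\<^sup>2 + (cmod h21)\<^sup>2 + (cmod h22)\<^sup>2) / 2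
      - (cmod (g11 + g22))\<^sup>2 / 2
      + ((cmod (z11 * y22 - z12 * y21))\<^sup>2 + (cmod (z12 * y11 - z11 * y12))\<^sup>2
       + (cmod (z21 * y22 - z22 * y21))\<^sup>2 + (cmod (z22 * y11 - z21 * y12))\<^sup>2
       + (cmod (z11 * y22 - z12 * y21 + z22 * y11 - z21 * y12))\<^sup>2) / 2"
proof -
  \<comment> \<open>Over the complex numbers each squared modulus becomes \<open>u * cnj u\<close>,
    so the claim, doubled to clear the halves, is a polynomial identity in the variables and their
    conjugates.\<close>
  have "complex_of_real (2 * (n * ((cmod z11)\<^sup>2 + (cmod z12)\<^sup>2 + (cmod z21)\<^sup>2 + (cmod z22)\<^sup>2)))
    = complex_of_real (2 * ((cmod g11)\<^sup>2 + (cmod g12)\<^sup>2 + (cmod g21)\<^sup>2 + (cmod g22)\<^sup>2)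
      + ((cmod h11)\<^sup>2 + (cmod h12)\<^sup>2 + (cmod h21)\<^sup>2 + (cmod h22)\<^sup>2)
      - (cmod (g11 + g22))\<^sup>2
      + ((cmod (z11 * y22 - z12 * y21))\<^sup>2 + (cmod (z12 * y11 - z11 * y12))\<^sup>2
       + (cmod (z21 * y22 - z22 * y21))\<^sup>2 + (cmod (z22 * y11 - z21 * y12))\<^sup>2
       + (cmod (z11 * y22 - z12 * y21 + z22 * y11 - z21 * y12))\<^sup>2))"
    unfolding n_def g11_def g12_def g21_def g22_def h11_def h12_def h21_def h22_def
    unfolding of_real_add of_real_mult of_real_diff complex_norm_square
    by (simp add: algebra_simps)
  then show ?thesis unfolding of_real_eq_iff by (simp add: field_simps)
qed

text \<open>
  Here \<open>z\<close> is the matrix \<open>Z = A Y + Y B\<^sup>T\<close>. With half the sum \<open>c\<close> of the traces and the traceless parts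
  \<open>P\<close>, \<open>Q\<close> of \<open>A\<close>, \<open>B\<close>, the constant is \<open>4\<bar>c\<bar>\<^sup>2 + \<parallel>P\<parallel>\<^sup>2 + 2\<parallel>Q\<parallel>\<^sup>2\<close>. Pairing \<open>Z\<close> with itself and
  completing squares bounds the adjoint of \<open>(c, P, Q) \<mapsto> Z\<close>, which is the dual identity.
\<close>

lemma sylvester_2_weighted_bound:
  fixes a11 a12 a21 a22 b11 b12 b21 b22 y11 y12 y21 y22 :: complex
  defines "z11 \<equiv> a11 * y11 + a12 * y21 + b11 * y11 + b12 * y12"
    and "z12 \<equiv> a11 * y12 + a12 * y22 + b21 * y11 + b22 * y12"
    and "z21 \<equiv> a21 * y11 + a22 * y21 + b11 * y21 + b12 * y22"
    and "z22 \<equiv> a21 * y12 + a22 * y22 + b21 * y21 + b22 * y22"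
  shows "(cmod z11)\<^sup>2 + (cmod z12)\<^sup>2 + (cmod z21)\<^sup>2 + (cmod z22)\<^sup>2
    \<le> ((cmod (a11 + a22 + b11 + b22))\<^sup>2
       + ((cmod a11)\<^sup>2 + (cmod a12)\<^sup>2 + (cmod a21)\<^sup>2 + (cmod a22)\<^sup>2) - (cmod (a11 + a22))\<^sup>2 / 2
       + 2 * ((cmod b11)\<^sup>2 + (cmod b12)\<^sup>2 + (cmod b21)\<^sup>2 + (cmod b22)\<^sup>2) - (cmod (b11 + b22))\<^sup>2)
      * ((cmod y11)\<^sup>2 + (cmod y12)\<^sup>2 + (cmod y21)\<^sup>2 + (cmod y22)\<^sup>2)"
proof -
  define n where "n = (cmod y11)\<^sup>2 + (cmod y12)\<^sup>2 + (cmod y21)\<^sup>2 + (cmod y22)\<^sup>2"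
  define N where "N = (cmod z11)\<^sup>2 + (cmod z12)\<^sup>2 + (cmod z21)\<^sup>2 + (cmod z22)\<^sup>2"
  define g11 g12 g21 g22 where "g11 = z11 * cnj y11 + z12 * cnj y12" and "g12 = z11 * cnj y21 + z12 * cnj y22"
    and "g21 = z21 * cnj y11 + z22 * cnj y12" and "g22 = z21 * cnj y21 + z22 * cnj y22"
  define h11 h12 h21 h22 where "h11 = z11 * cnj y11 + z21 * cnj y21" and "h12 = z11 * cnj y12 + z21 * cnj y22"
    and "h21 = z12 * cnj y11 + z22 * cnj y21" and "h22 = z12 * cnj y12 + z22 * cnj y22"
  define t where "t = g11 + g22"
  define p q c where "p = (a11 - a22) / 2" and "q = (b11 - b22) / 2" and "c = (a11 + a22 + b11 + b22) / 2"
  define gd hd where "gd = (g11 - g22) / 2" and "hd = (h11 - h22) / 2"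
  \<comment> \<open>\<open>K\<close> weights the scalar part, P and Q by 4, 1 and 2.
    \<open>L\<close> measures the dual quantities with the reciprocal weights 1/4, 1 and 1/2: the
    common trace \<open>t\<close> of both products and the traceless parts of the matrices
    \<open>g\<close> and \<open>h\<close>.\<close>
  define K where "K = 4 * (cmod c)\<^sup>2 + (2 * (cmod p)\<^sup>2 + (cmod a12)\<^sup>2 + (cmod a21)\<^sup>2)
      + 2 * (2 * (cmod q)\<^sup>2 + (cmod b12)\<^sup>2 + (cmod b21)\<^sup>2)"
  define L where "L = (cmod t)\<^sup>2 / 4 + (2 * (cmod gd)\<^sup>2 + (cmod g12)\<^sup>2 + (cmod g21)\<^sup>2)
      + (2 * (cmod hd)\<^sup>2 + (cmod h12)\<^sup>2 + (cmod h21)\<^sup>2) / 2"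
  have th: "t = h11 + h22" by (simp add: t_def g11_def g22_def h11_def h22_def)
  have par: "2 * (cmod ((u - v) / 2))\<^sup>2 = (cmod u)\<^sup>2 + (cmod v)\<^sup>2 - (cmod (u + v))\<^sup>2 / 2" for u v
    unfolding cmod_power2 by (simp add: power2_eq_square field_simps)
  have K: "K = (cmod (a11 + a22 + b11 + b22))\<^sup>2
       + ((cmod a11)\<^sup>2 + (cmod a12)\<^sup>2 + (cmod a21)\<^sup>2 + (cmod a22)\<^sup>2) - (cmod (a11 + a22))\<^sup>2 / 2
       + 2 * ((cmod b11)\<^sup>2 + (cmod b12)\<^sup>2 + (cmod b21)\<^sup>2 + (cmod b22)\<^sup>2) - (cmod (b11 + b22))\<^sup>2"
    unfolding K_def p_def q_def par by (simp add: c_def norm_divide power_divide)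
  have L: "L = ((cmod g11)\<^sup>2 + (cmod g12)\<^sup>2 + (cmod g21)\<^sup>2 + (cmod g22)\<^sup>2)
      + ((cmod h11)\<^sup>2 + (cmod h12)\<^sup>2 + (cmod h21)\<^sup>2 + (cmod h22)\<^sup>2) / 2 - (cmod t)\<^sup>2 / 2"
    unfolding L_def gd_def hd_def par th[symmetric] t_def[symmetric] by (simp add: field_simps)
  \<comment> \<open>\<open>L\<close> is the dual identity without its last bracket, which is a sum
    of squares.\<close>
  have Lle: "L \<le> n * N"
    using sylvester_2_dual_identity[of y11 y12 y21 y22 z11 z12 z21 z22] unfolding L n_def N_def
    unfolding g11_def g12_def g21_def g22_def h11_def h12_def h21_def h22_def t_def
    by (simp add: add_nonneg_nonneg)
  \<comment> \<open>The squared norm of Z is the inner product of Z with A Y + Y B^T; moving Y to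
    the other side pairs A with \<open>g\<close> and B with \<open>h\<close>.\<close>
  have "complex_of_real N = a11 * cnj g11 + a12 * cnj g12 + a21 * cnj g21 + a22 * cnj g22
     + b11 * cnj h11 + b12 * cnj h12 + b21 * cnj h21 + b22 * cnj h22"
    unfolding N_def of_real_add complex_norm_square
    unfolding g11_def g12_def g21_def g22_def h11_def h12_def h21_def h22_def
    by (simp add: z11_def z12_def z21_def z22_def algebra_simps)
  also have "\<dots> = c * cnj t + 2 * p * cnj gd + a12 * cnj g12 + a21 * cnj g21
     + 2 * q * cnj hd + b12 * cnj h12 + b21 * cnj h21"
  proof -
    have "a11 * cnj g11 + a22 * cnj g22 = (a11 + a22) / 2 * cnj t + 2 * p * cnj gd"
      by (simp add: p_def gd_def t_def field_simps)
    moreover have "b11 * cnj h11 + b22 * cnj h22 = (b11 + b22) / 2 * cnj t + 2 * q * cnj hd"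
      by (simp add: q_def hd_def th field_simps)
    ultimately show ?thesis by (simp add: c_def field_simps)
  qed
  finally have NN: "complex_of_real N = \<dots>" .
  have "2 * n * N = 2 * Re (of_real n * of_real N)" by simp
  \<comment> \<open>The factors 2 and 1/2 are distributed so that applying
    \<open>two_Re_mult_cnj_le\<close> to each product yields exactly the weights of \<open>K\<close>
    and \<open>L\<close>.\<close>
  also have "\<dots> = 2 * Re ((2 * of_real n * c) * cnj (t / 2)) + 2 * (2 * Re ((of_real n * p) * cnj gd))
     + 2 * Re ((of_real n * a12) * cnj g12) + 2 * Re ((of_real n * a21) * cnj g21)
     + (2 * Re ((2 * of_real n * q) * cnj hd)
     + (2 * Re ((2 * of_real n * b12) * cnj h12) + 2 * Re ((2 * of_real n * b21) * cnj h21)) / 2) "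
    unfolding NN by (simp add: algebra_simps)
  also have "\<dots> \<le> ((cmod (2 * of_real n * c))\<^sup>2 + (cmod (t / 2))\<^sup>2) + 2 * ((cmod (of_real n * p))\<^sup>2 + (cmod gd)\<^sup>2)
     + ((cmod (of_real n * a12))\<^sup>2 + (cmod g12)\<^sup>2) + ((cmod (of_real n * a21))\<^sup>2 + (cmod g21)\<^sup>2)
     + (((cmod (2 * of_real n * q))\<^sup>2 + (cmod hd)\<^sup>2)
     + (((cmod (2 * of_real n * b12))\<^sup>2 + (cmod h12)\<^sup>2) + ((cmod (2 * of_real n * b21))\<^sup>2 + (cmod h21)\<^sup>2)) / 2)"
    by (intro add_mono mult_left_mono divide_right_mono two_Re_mult_cnj_le) simp_all
  also have "\<dots> = n\<^sup>2 * K + L"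
    by (simp add: K_def L_def norm_mult norm_divide power_mult_distrib power_divide field_simps)
  \<comment> \<open>The bound \<open>L \<le> n * N\<close> lets half of the left side absorb
    \<open>L\<close>. Cancelling \<open>n\<close> then leaves only the case Y = 0, where Z vanishes
    too.\<close>
  finally have "2 * (n * N) \<le> n * (n * K) + n * N"
    using Lle unfolding power2_eq_square mult.assoc by linarith
  then have *: "n * N \<le> n * (n * K)" by linarith
  have "N \<le> n * K"
  proof (cases "n = 0")
    case True
    then have "y11 = 0 \<and> y12 = 0 \<and> y21 = 0 \<and> y22 = 0"
      unfolding n_def by (smt (verit) zero_le_power2 power_eq_0_iff norm_eq_zero)
    then show ?thesis using True by (simp add: N_def z11_def z12_def z21_def z22_def)
  next
    case False
    moreover have "n \<ge> 0" by (simp add: n_def)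
    ultimately show ?thesis using * by simp
  qed
  then show ?thesis unfolding K N_def n_def by (simp add: mult.commute)
qed

text \<open>Each entry of Z is a row of A times a column of Y plus a row of B times a row of Y.
  Cauchy-Schwarz bounds both products, and summing over the entries gives products of squared
  Frobenius norms.\<close>

lemma sylvester_2_coarse_bound:
  fixes a11 a12 a21 a22 b11 b12 b21 b22 y11 y12 y21 y22 :: complex
  defines "z11 \<equiv> a11 * y11 + a12 * y21 + b11 * y11 + b12 * y12"
    and "z12 \<equiv> a11 * y12 + a12 * y22 + b21 * y11 + b22 * y12"
    and "z21 \<equiv> a21 * y11 + a22 * y21 + b11 * y21 + b12 * y22"
    and "z22 \<equiv> a21 * y12 + a22 * y22 + b21 * y21 + b22 * y22"
  shows "(cmod z11)\<^sup>2 + (cmod z12)\<^sup>2 + (cmod z21)\<^sup>2 + (cmod z22)\<^sup>2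
    \<le> (2 * ((cmod a11)\<^sup>2 + (cmod a12)\<^sup>2 + (cmod a21)\<^sup>2 + (cmod a22)\<^sup>2)
       + 2 * ((cmod b11)\<^sup>2 + (cmod b12)\<^sup>2 + (cmod b21)\<^sup>2 + (cmod b22)\<^sup>2))
      * ((cmod y11)\<^sup>2 + (cmod y12)\<^sup>2 + (cmod y21)\<^sup>2 + (cmod y22)\<^sup>2)"
proof -
  have *: "(cmod (a * x + b * y + c * u + d * v))\<^sup>2
    \<le> 2 * (((cmod a)\<^sup>2 + (cmod b)\<^sup>2) * ((cmod x)\<^sup>2 + (cmod y)\<^sup>2))
     + 2 * (((cmod c)\<^sup>2 + (cmod d)\<^sup>2) * ((cmod u)\<^sup>2 + (cmod v)\<^sup>2))" for a b c d x y u v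
    using cmod_add_power2_le[of "a * x + b * y" "c * u + d * v"]
      cmod_inner2_power2_le[of a x b y] cmod_inner2_power2_le[of c u d v] by (simp add: add.assoc)
  show ?thesis unfolding z11_def z12_def z21_def z22_def
    by (rule order_trans[OF add_mono[OF add_mono[OF add_mono[OF * *] *] *]])
      (simp add: algebra_simps)
qed

section \<open>Gram matrices and their eigenvalues\<close>

lemma dim_mat_adjoint [simp]:
  "dim_row (mat_adjoint A) = dim_col A" "dim_col (mat_adjoint A) = dim_row A"
  by (simp_all add: mat_adjoint_def)

lemma mat_adjoint_carrier [simp]: "mat_adjoint A \<in> carrier_mat n m \<longleftrightarrow> A \<in> carrier_mat m n"
  unfolding carrier_mat_def by auto

lemma index_mat_adjoint [simp]:
  fixes A :: "complex mat"
  assumes "i < dim_col A" "j < dim_row A"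
  shows "mat_adjoint A $$ (i, j) = cnj (A $$ (j, i))"
  using assms by (simp add: mat_adjoint_def mat_of_rows_index)

lemma index_mult_mat_sum:
  assumes "i < dim_row A" "j < dim_col B" "dim_col A = dim_row B"
  shows "(A * B) $$ (i, j) = (\<Sum>k<dim_row B. A $$ (i, k) * B $$ (k, j))"
  using assms by (simp add: scalar_prod_def atLeast0LessThan)

lemma mat_adjoint_mult:
  fixes A :: "complex mat"
  assumes "A \<in> carrier_mat n m" "B \<in> carrier_mat m p"
  shows "mat_adjoint (A * B) = mat_adjoint B * mat_adjoint A"
  using assms
  by (intro eq_matI) (auto simp: index_mult_mat_sum simp del: index_mult_mat(1) intro!: sum.cong)

lemma mat_adjoint_adjoint [simp]: "mat_adjoint (mat_adjoint A) = (A :: complex mat)"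
  by (intro eq_matI) auto

lemma mtrace_eq_sum_list_diag_mat: "A \<in> carrier_mat n n \<Longrightarrow> mtrace A = sum_list (diag_mat A)"
  by (simp add: mtrace_def diag_mat_def sum_list_sum_nth atLeast0LessThan)

lemma mtrace_comm:
  assumes "A \<in> carrier_mat n m" "B \<in> carrier_mat m n"
  shows "mtrace (A * B) = mtrace (B * A)"
proof -
  have "mtrace (A * B) = (\<Sum>i<n. \<Sum>k<m. A $$ (i, k) * B $$ (k, i))"
    using assms by (auto simp: mtrace_def index_mult_mat_sum simp del: index_mult_mat(1))
  also have "\<dots> = (\<Sum>k<m. \<Sum>i<n. B $$ (k, i) * A $$ (i, k))"
    by (subst sum.swap) (simp add: mult.commute)
  also have "\<dots> = mtrace (B * A)"
    using assms by (auto simp: mtrace_def index_mult_mat_sum simp del: index_mult_mat(1))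
  finally show ?thesis .
qed

lemma mtrace_adjoint_mult_self:
  "mtrace (mat_adjoint A * A) = of_real (\<Sum>i<dim_col A. \<Sum>k<dim_row A. (cmod (A $$ (k, i)))\<^sup>2)"
  by (simp add: mtrace_def index_mult_mat_sum complex_norm_square mult.commute
      del: index_mult_mat(1) of_real_power)

lemma fro_norm_power2:
  "fro_norm A ^ 2 = (\<Sum>i<dim_col A. \<Sum>k<dim_row A. (cmod (A $$ (k, i)))\<^sup>2)"
  by (simp add: fro_norm_def mtrace_adjoint_mult_self sum_nonneg)

lemma mtrace_adjoint_mult_self_fro: "mtrace (mat_adjoint A * A) = of_real (fro_norm A ^ 2)"
  unfolding fro_norm_power2 by (rule mtrace_adjoint_mult_self)

section \<open>Invariance under unitary conjugation\<close>

lemma unitary_matD: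
  assumes "unitary_mat n U"
  shows "U \<in> carrier_mat n n" "mat_adjoint U \<in> carrier_mat n n"
    "mat_adjoint U * U = 1\<^sub>m n" "U * mat_adjoint U = 1\<^sub>m n"
  using assms by (auto simp: unitary_mat_def)

lemma mtrace_unitary_conj:
  assumes "unitary_mat n U" "A \<in> carrier_mat n n"
  shows "mtrace (U * A * mat_adjoint U) = mtrace A"
proof -
  note U = unitary_matD[OF assms(1)]
  have "mtrace (U * A * mat_adjoint U) = mtrace (mat_adjoint U * (U * A))"
    using U assms(2) by (intro mtrace_comm[of _ n n]) auto
  also have "mat_adjoint U * (U * A) = A"
    using U assms(2) by (subst assoc_mult_mat[symmetric, of _ n n _ n _ n]) auto
  finally show ?thesis .
qed

lemma unitary_conj_mult:
  assumes "unitary_mat n U" "A \<in> carrier_mat n n" "B \<in> carrier_mat n n"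
  shows "U * A * mat_adjoint U * (U * B * mat_adjoint U) = U * (A * B) * mat_adjoint U"
proof -
  note U = unitary_matD[OF assms(1)]
  let ?D = "mat_adjoint U"
  have "U * A * ?D * (U * B * ?D) = U * A * (?D * (U * (B * ?D)))"
    using U assms(2,3) by (simp add: assoc_mult_mat[of _ n n _ n _ n])
  also have "?D * (U * (B * ?D)) = B * ?D"
    using U assms(2,3) by (subst assoc_mult_mat[symmetric, of _ n n _ n _ n]) auto
  finally show ?thesis
    using U assms(2,3) by (simp add: assoc_mult_mat[of _ n n _ n _ n])
qed

lemma mat_adjoint_unitary_conj:
  assumes "unitary_mat n U" "A \<in> carrier_mat n n"
  shows "mat_adjoint (U * A * mat_adjoint U) = U * mat_adjoint A * mat_adjoint U"
proof -
  note U = unitary_matD[OF assms(1)]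
  have "mat_adjoint (U * A * mat_adjoint U) = mat_adjoint (mat_adjoint U) * mat_adjoint (U * A)"
    using U assms(2) by (intro mat_adjoint_mult[of _ n n _ n]) auto
  also have "mat_adjoint (U * A) = mat_adjoint A * mat_adjoint U"
    using U assms(2) by (intro mat_adjoint_mult[of _ n n _ n]) auto
  finally show ?thesis
    using U assms(2) by (simp add: assoc_mult_mat[of _ n n _ n _ n])
qed

lemma gram_unitary_conj:
  assumes "unitary_mat n U" "A \<in> carrier_mat n n"
  shows "mat_adjoint (U * A * mat_adjoint U) * (U * A * mat_adjoint U)
    = U * (mat_adjoint A * A) * mat_adjoint U"
  using assms by (simp add: mat_adjoint_unitary_conj unitary_conj_mult)

lemma fro_norm_unitary_conj:
  assumes "unitary_mat n U" "A \<in> carrier_mat n n"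
  shows "fro_norm (U * A * mat_adjoint U) = fro_norm A"
  unfolding fro_norm_def gram_unitary_conj[OF assms]
  by (subst mtrace_unitary_conj[OF assms(1)]) (use assms(2) in auto)

lemma char_poly_unitary_conj:
  assumes "unitary_mat n U" "A \<in> carrier_mat n n"
  shows "char_poly (U * A * mat_adjoint U) = char_poly A"
  using unitary_matD[OF assms(1)] assms(2)
  by (intro char_poly_similar similar_matI[of _ _ U "mat_adjoint U" n]) auto

lemma char_poly_gram_unitary_conj:
  assumes "unitary_mat n U" "A \<in> carrier_mat n n"
  shows "char_poly (mat_adjoint (U * A * mat_adjoint U) * (U * A * mat_adjoint U))
    = char_poly (mat_adjoint A * A)"
  unfolding gram_unitary_conj[OF assms]
  by (rule char_poly_unitary_conj[OF assms(1)]) (use assms(2) in auto)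

section \<open>Roots of the characteristic polynomial of a Gram matrix\<close>

lemma char_poly_neq_0: "A \<in> carrier_mat n n \<Longrightarrow> char_poly A \<noteq> 0"
  using degree_monic_char_poly[of A n] by auto

text \<open>The trace is invariant under similarity, so it can be read off a Schur form, whose
  diagonal lists the roots with multiplicity.\<close>

lemma sum_mset_proots_char_poly:
  fixes A :: "complex mat"
  assumes A: "A \<in> carrier_mat n n"
  shows "sum_mset (proots (char_poly A)) = mtrace A"
proof -
  obtain es where es: "char_poly A = (\<Prod>a\<leftarrow>es. [:- a, 1:])"
    using char_poly_factorized[OF A] by auto
  obtain B where B: "B \<in> carrier_mat n n" "upper_triangular B" "similar_mat A B"
    using schur_decomposition_exists[OF A es] by auto
  obtain k P Q where PQ: "{A, B, P, Q} \<subseteq> carrier_mat k k" "Q * P = 1\<^sub>m k" "A = P * B * Q"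
    using similar_matD[OF B(3)] by blast
  then have "k = n" using A by (metis carrier_matD(1) insert_subset)
  then have PQ: "P \<in> carrier_mat n n" "Q \<in> carrier_mat n n" "Q * P = 1\<^sub>m n" "A = P * B * Q"
    using PQ by auto
  have "mtrace A = mtrace (Q * (P * B))"
    unfolding PQ(4) by (rule mtrace_comm[of _ n n]) (use PQ(1,2) B(1) in auto)
  also have "Q * (P * B) = B"
    using PQ B(1) by (subst assoc_mult_mat[symmetric, of _ n n _ n _ n]) auto
  also have "mtrace B = sum_list (diag_mat B)"
    using B(1) by (rule mtrace_eq_sum_list_diag_mat)
  also have "\<dots> = sum_mset (proots (char_poly B))"
  proof -
    have "proots (\<Prod>a\<leftarrow>as. [:- a, 1:]) = mset as" for as :: "complex list"
    proof (induction as)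
      case (Cons a as)
      have "(\<Prod>a\<leftarrow>as. [:- a, 1:]) \<noteq> 0"
        by (auto simp: prod_list_zero_iff)
      then show ?case using Cons by (simp add: proots_mult del: mult_pCons_left)
    qed simp
    then show ?thesis
      unfolding char_poly_upper_triangular[OF B(1,2)] by (simp add: sum_mset_sum_list)
  qed
  finally show ?thesis using char_poly_similar[OF B(3)] by simp
qed

text \<open>A multiset keeps multiplicities, and direct sums of matrices become sums of multisets.
  The elements stay complex as roots of a complex polynomial; the squared singular values are their
  real parts.\<close>

abbreviation sq_singular_values :: "complex mat \<Rightarrow> complex multiset" where
  "sq_singular_values M \<equiv> proots (char_poly (mat_adjoint M * M))"

lemma gram_quadratic_form:
  fixes M :: "complex mat" and x :: "complex vec"
  assumes "M \<in> carrier_mat m n" "x \<in> carrier_vec n"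
  shows "(\<Sum>i<n. cnj (x $ i) * ((mat_adjoint M * M) *\<^sub>v x) $ i)
    = of_real (\<Sum>k<m. (cmod ((M *\<^sub>v x) $ k))\<^sup>2)"
proof -
  have "(\<Sum>i<n. cnj (x $ i) * ((mat_adjoint M * M) *\<^sub>v x) $ i)
    = (\<Sum>i<n. cnj (x $ i) * (mat_adjoint M *\<^sub>v (M *\<^sub>v x)) $ i)"
    using assms by (subst assoc_mult_mat_vec[of _ n m _ n]) auto
  also have "\<dots> = (\<Sum>i<n. \<Sum>k<m. cnj (x $ i) * (cnj (M $$ (k, i)) * (M *\<^sub>v x) $ k))"
    using assms by (intro sum.cong) (auto simp: scalar_prod_def atLeast0LessThan sum_distrib_left)
  also have "\<dots> = (\<Sum>k<m. (M *\<^sub>v x) $ k * cnj ((M *\<^sub>v x) $ k))"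
    using assms by (subst sum.swap)
      (auto simp: scalar_prod_def atLeast0LessThan sum_distrib_left sum_distrib_right mult_ac
        intro!: sum.cong)
  finally show ?thesis by (simp add: complex_norm_square del: of_real_power)
qed

text \<open>An eigenvector turns the algebraic root \<open>e\<close> into the quotient of the
  squared norms of \<open>M *\<^sub>v x\<close> and \<open>x\<close>, so a bound on the action of
  \<open>M\<close> becomes a bound on \<open>Re e\<close>.\<close>

lemma gram_eigenvalue:
  fixes M :: "complex mat"
  assumes M: "M \<in> carrier_mat m n" and e: "e \<in># sq_singular_values M"
  obtains x where "x \<in> carrier_vec n" "(\<Sum>i<n. (cmod (x $ i))\<^sup>2) > 0"
    "Re e * (\<Sum>i<n. (cmod (x $ i))\<^sup>2) = (\<Sum>k<m. (cmod ((M *\<^sub>v x) $ k))\<^sup>2)"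
proof -
  let ?G = "mat_adjoint M * M"
  have G: "?G \<in> carrier_mat n n" using M by auto
  have "poly (char_poly ?G) e = 0"
    using e char_poly_neq_0[OF G] by simp
  then obtain x where x: "x \<in> carrier_vec n" "x \<noteq> 0\<^sub>v n" "?G *\<^sub>v x = e \<cdot>\<^sub>v x"
    using eigenvalue_root_char_poly[OF G]
    unfolding eigenvalue_def eigenvector_def carrier_matD(1)[OF G] by blast
  have "of_real (\<Sum>k<m. (cmod ((M *\<^sub>v x) $ k))\<^sup>2) = (\<Sum>i<n. cnj (x $ i) * (e * x $ i))"
    using gram_quadratic_form[OF M x(1)] x(1) unfolding x(3) by simp
  also have "\<dots> = e * of_real (\<Sum>i<n. (cmod (x $ i))\<^sup>2)"
    by (simp add: complex_norm_square sum_distrib_left mult_ac del: of_real_power)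
  finally have "Re (of_real (\<Sum>k<m. (cmod ((M *\<^sub>v x) $ k))\<^sup>2))
      = Re (e * of_real (\<Sum>i<n. (cmod (x $ i))\<^sup>2))" by (rule arg_cong)
  then have "Re e * (\<Sum>i<n. (cmod (x $ i))\<^sup>2) = (\<Sum>k<m. (cmod ((M *\<^sub>v x) $ k))\<^sup>2)"
    by simp
  moreover obtain i where "i < n" "x $ i \<noteq> 0"
    using x(1,2) by (metis carrier_vecD eq_vecI index_zero_vec)
  then have "(\<Sum>i<n. (cmod (x $ i))\<^sup>2) > 0"
    by (intro sum_pos2[of _ i]) auto
  ultimately show ?thesis using that x(1) by blast
qed

lemma gram_eigenvalue_nonneg:
  assumes "M \<in> carrier_mat m n" "e \<in># sq_singular_values M"
  shows "0 \<le> Re e"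
proof -
  obtain x where x: "(\<Sum>i<n. (cmod (x $ i))\<^sup>2) > 0"
    "Re e * (\<Sum>i<n. (cmod (x $ i))\<^sup>2) = (\<Sum>k<m. (cmod ((M *\<^sub>v x) $ k))\<^sup>2)"
    using gram_eigenvalue[OF assms] by metis
  have "0 \<le> Re e * (\<Sum>i<n. (cmod (x $ i))\<^sup>2)" unfolding x(2) by (simp add: sum_nonneg)
  then show ?thesis using x(1) by (simp add: zero_le_mult_iff)
qed

lemma gram_eigenvalue_le:
  assumes "M \<in> carrier_mat m n" "e \<in># sq_singular_values M"
    and "\<And>x. x \<in> carrier_vec n \<Longrightarrow>
      (\<Sum>k<m. (cmod ((M *\<^sub>v x) $ k))\<^sup>2) \<le> K * (\<Sum>i<n. (cmod (x $ i))\<^sup>2)"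
  shows "Re e \<le> K"
proof -
  obtain x where x: "x \<in> carrier_vec n" "(\<Sum>i<n. (cmod (x $ i))\<^sup>2) > 0"
    "Re e * (\<Sum>i<n. (cmod (x $ i))\<^sup>2) = (\<Sum>k<m. (cmod ((M *\<^sub>v x) $ k))\<^sup>2)"
    using gram_eigenvalue[OF assms(1,2)] by metis
  then show ?thesis using assms(3)[OF x(1)] by (metis mult_le_cancel_right_pos)
qed

text \<open>All roots together sum to the trace of the Gram matrix, which is the squared Frobenius
  norm, and the roots other than the pair contribute a nonnegative real part. The sub-multiset
  hypothesis allows \<open>e = f\<close> only for a multiple root.\<close>

lemma gram_eigenvalue_pair_le:
  assumes M: "M \<in> carrier_mat m n" and sub: "{#e, f#} \<subseteq># sq_singular_values M"
  shows "Re e + Re f \<le> fro_norm M ^ 2"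
proof -
  let ?R = "sq_singular_values M"
  define S where "S = ?R - {#e, f#}"
  have R: "?R = {#e, f#} + S" using sub by (metis S_def subset_mset.add_diff_inverse)
  have "0 \<le> Re (sum_mset S)" if "S \<subseteq># ?R" for S
    using that
  proof (induction S)
    case (add x S)
    have "x \<in># ?R" using add.prems by (auto dest: mset_subset_eqD)
    moreover have "S \<subseteq># ?R"
      using add.prems by (meson mset_subset_eq_insertD subset_mset.less_imp_le)
    ultimately show ?case using add.IH gram_eigenvalue_nonneg[OF M] by (simp add: add_nonneg_nonneg)
  qed simp
  then have "0 \<le> Re (sum_mset S)" by (simp add: S_def)
  moreover have "sum_mset ?R = of_real (fro_norm M ^ 2)"
    using M by (subst sum_mset_proots_char_poly[of _ n]) (auto simp: mtrace_adjoint_mult_self_fro)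
  then have "Re (sum_mset ?R) = fro_norm M ^ 2" by simp
  ultimately show ?thesis unfolding R by simp
qed

section \<open>Direct sums of two blocks\<close>

lemma char_poly_four_block_diag:
  fixes A D :: "'a :: idom mat"
  assumes A: "A \<in> carrier_mat n n" and D: "D \<in> carrier_mat m m"
  shows "char_poly (four_block_mat A (0\<^sub>m n m) (0\<^sub>m m n) D) = char_poly A * char_poly D"
proof -
  have "char_poly_matrix (four_block_mat A (0\<^sub>m n m) (0\<^sub>m m n) D)
    = four_block_mat (char_poly_matrix A) (0\<^sub>m n m) (0\<^sub>m m n) (char_poly_matrix D)"
    using A D by (intro eq_matI) (auto simp: char_poly_matrix_def one_poly_def)
  then show ?thesis unfolding char_poly_def
    using A D by (simp add: det_four_block_mat_upper_right_zero[of _ n _ m])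
qed

lemma mat_adjoint_four_block_diag:
  fixes A D :: "complex mat"
  assumes "A \<in> carrier_mat n n" "D \<in> carrier_mat m m"
  shows "mat_adjoint (four_block_mat A (0\<^sub>m n m) (0\<^sub>m m n) D)
    = four_block_mat (mat_adjoint A) (0\<^sub>m n m) (0\<^sub>m m n) (mat_adjoint D)"
  using assms by (intro eq_matI) auto

lemma gram_four_block_diag:
  fixes A D :: "complex mat"
  assumes "A \<in> carrier_mat n n" "D \<in> carrier_mat m m"
  shows "mat_adjoint (four_block_mat A (0\<^sub>m n m) (0\<^sub>m m n) D) * four_block_mat A (0\<^sub>m n m) (0\<^sub>m m n) D
    = four_block_mat (mat_adjoint A * A) (0\<^sub>m n m) (0\<^sub>m m n) (mat_adjoint D * D)"
  unfolding mat_adjoint_four_block_diag[OF assms] using assms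
  by (subst mult_four_block_mat[of _ n n _ m _ m _ _ n _ m]) auto

lemma proots_gram_four_block_diag:
  fixes A D :: "complex mat"
  assumes A: "A \<in> carrier_mat n n" and D: "D \<in> carrier_mat m m"
  defines "M \<equiv> four_block_mat A (0\<^sub>m n m) (0\<^sub>m m n) D"
  shows "sq_singular_values M
    = sq_singular_values A + sq_singular_values D"
proof -
  have "mat_adjoint A * A \<in> carrier_mat n n" "mat_adjoint D * D \<in> carrier_mat m m"
    using A D by auto
  then show ?thesis unfolding M_def gram_four_block_diag[OF A D]
    by (subst char_poly_four_block_diag[of _ n _ m]) (auto simp: proots_mult char_poly_neq_0)
qed

lemma mtrace_four_block_diag:
  assumes "A \<in> carrier_mat n n" "D \<in> carrier_mat m m"
  shows "mtrace (four_block_mat A B C D) = mtrace A + mtrace D"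
  using assms by (simp add: mtrace_eq_sum_list_diag_mat[of _ "n + m"] mtrace_eq_sum_list_diag_mat
      diag_four_block_mat[of _ n _ m])

lemma fro_norm_four_block_diag:
  fixes A D :: "complex mat"
  assumes "A \<in> carrier_mat n n" "D \<in> carrier_mat m m"
  shows "fro_norm (four_block_mat A (0\<^sub>m n m) (0\<^sub>m m n) D) ^ 2 = fro_norm A ^ 2 + fro_norm D ^ 2"
proof -
  have "complex_of_real (fro_norm (four_block_mat A (0\<^sub>m n m) (0\<^sub>m m n) D) ^ 2)
    = of_real (fro_norm A ^ 2 + fro_norm D ^ 2)"
    using assms unfolding of_real_add mtrace_adjoint_mult_self_fro[symmetric] gram_four_block_diag[OF assms]
    by (intro mtrace_four_block_diag) auto
  then show ?thesis by (simp only: of_real_eq_iff)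
qed

section \<open>Kronecker sums\<close>

text \<open>An index \<open>k\<close> of a Kronecker product encodes the pair
  \<open>(k div p, k mod p)\<close>; this splits sums over such indices into double sums.\<close>

lemma sum_div_mod:
  "(\<Sum>k<m * p. f (k div p) (k mod p)) = (\<Sum>i<m. \<Sum>j<p. f i j :: 'a :: comm_monoid_add)" for m p :: nat
proof (cases "p = 0")
  case False
  have "(\<Sum>i<m. \<Sum>j<p. f i j) = (\<Sum>(i, j)\<in>{..<m} \<times> {..<p}. f i j)"
    by (rule sum.cartesian_product)
  also have "\<dots> = (\<Sum>k<m * p. f (k div p) (k mod p))"
  proof (rule sum.reindex_bij_witness[of _ "\<lambda>k. (k div p, k mod p)" "\<lambda>(i, j). i * p + j"])
    fix x assume x: "x \<in> {..<m} \<times> {..<p}"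
    then have "fst x * p + snd x < Suc (fst x) * p" by auto
    also have "\<dots> \<le> m * p" using x by (intro mult_right_mono) auto
    finally show "(case x of (i, j) \<Rightarrow> i * p + j) \<in> {..<m * p}" by (simp add: case_prod_unfold)
  qed (use False in \<open>auto simp: less_mult_imp_div_less\<close>)
  finally show ?thesis ..
qed simp

lemma dim_kron [simp]:
  "dim_row (kron A B) = dim_row A * dim_row B" "dim_col (kron A B) = dim_col A * dim_col B"
  by (simp_all add: kron_def)

lemma index_kron [simp]:
  assumes "i < dim_row A * dim_row B" "j < dim_col A * dim_col B"
  shows "kron A B $$ (i, j)
    = A $$ (i div dim_row B, j div dim_col B) * B $$ (i mod dim_row B, j mod dim_col B)"
  using assms by (simp add: kron_def)

lemma kron_carrier [intro]:
  "A \<in> carrier_mat n m \<Longrightarrow> B \<in> carrier_mat p q \<Longrightarrow> kron A B \<in> carrier_mat (n * p) (m * q)"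
  by (auto intro!: carrier_matI)

lemma div_mod_less:
  assumes "i < n * m"
  shows "i div m < n" "i mod m < (m :: nat)"
  using assms by (auto simp: less_mult_imp_div_less intro!: mod_less_divisor gr0I)

text \<open>Mixed-product rule: the summation index splits into a pair, and the double sum
  factors.\<close>

lemma kron_mult_kron:
  assumes "A \<in> carrier_mat n m" "C \<in> carrier_mat m l" "B \<in> carrier_mat p q" "D \<in> carrier_mat q r"
  shows "kron A B * kron C D = kron (A * C) (B * D)"
proof (rule eq_matI)
  fix i j assume "i < dim_row (kron (A * C) (B * D))" "j < dim_col (kron (A * C) (B * D))"
  then have ij: "i < n * p" "j < l * r" using assms by auto
  note d = div_mod_less[OF ij(1)] div_mod_less[OF ij(2)]
  have "(kron A B * kron C D) $$ (i, j)
    = (\<Sum>k<m * q. (A $$ (i div p, k div q) * B $$ (i mod p, k mod q))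
        * (C $$ (k div q, j div r) * D $$ (k mod q, j mod r)))"
    using assms ij by (simp add: index_mult_mat_sum del: index_mult_mat(1))
  also have "\<dots> = (\<Sum>k<m. \<Sum>k'<q. (A $$ (i div p, k) * B $$ (i mod p, k'))
        * (C $$ (k, j div r) * D $$ (k', j mod r)))"
    by (rule sum_div_mod)
  also have "\<dots> = (\<Sum>k<m. A $$ (i div p, k) * C $$ (k, j div r))
      * (\<Sum>k'<q. B $$ (i mod p, k') * D $$ (k', j mod r))"
    by (simp add: sum_product mult_ac)
  also have "\<dots> = kron (A * C) (B * D) $$ (i, j)"
    using assms ij d by (simp add: index_mult_mat_sum del: index_mult_mat(1))
  finally show "(kron A B * kron C D) $$ (i, j) = kron (A * C) (B * D) $$ (i, j)" .
qed (use assms in auto)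

lemma kron_one_one: "kron (1\<^sub>m n) (1\<^sub>m m) = 1\<^sub>m (n * m)"
proof (rule eq_matI)
  fix i j assume "i < dim_row (1\<^sub>m (n * m))" "j < dim_col (1\<^sub>m (n * m))"
  then have ij: "i < n * m" "j < n * m" by auto
  have "i = j" if "i div m = j div m" "i mod m = j mod m"
    using that by (metis div_mult_mod_eq)
  then show "kron (1\<^sub>m n) (1\<^sub>m m) $$ (i, j) = 1\<^sub>m (n * m) $$ (i, j)"
    using ij div_mod_less[OF ij(1)] div_mod_less[OF ij(2)] by auto
qed auto

lemma mat_adjoint_kron: "mat_adjoint (kron A B) = kron (mat_adjoint A) (mat_adjoint B)"
  by (intro eq_matI) (auto simp: div_mod_less)

lemma unitary_mat_kron:
  assumes "unitary_mat n U" "unitary_mat m V"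
  shows "unitary_mat (n * m) (kron U V)"
  using unitary_matD[OF assms(1)] unitary_matD[OF assms(2)]
  by (auto simp: unitary_mat_def mat_adjoint_kron kron_mult_kron[of _ n n _ n _ m m _ m] kron_one_one)

text \<open>The matrix of the map taking Y to A Y + Y B^T when Y is written as a vector row by
  row.\<close>

definition kron_sum :: "complex mat \<Rightarrow> complex mat \<Rightarrow> complex mat" where
  "kron_sum A B = kron A (1\<^sub>m (dim_row B)) + kron (1\<^sub>m (dim_row A)) B"

lemma kron_sum_carrier [intro]:
  "A \<in> carrier_mat n n \<Longrightarrow> B \<in> carrier_mat m m \<Longrightarrow> kron_sum A B \<in> carrier_mat (n * m) (n * m)"
  by (auto simp: kron_sum_def intro!: carrier_matI)

lemma index_kron_sum:
  assumes "A \<in> carrier_mat n n" "B \<in> carrier_mat m m" "i < n * m" "j < n * m"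
  shows "kron_sum A B $$ (i, j)
    = (if i mod m = j mod m then A $$ (i div m, j div m) else 0)
    + (if i div m = j div m then B $$ (i mod m, j mod m) else 0)"
  using assms div_mod_less[OF assms(3)] div_mod_less[OF assms(4)] by (simp add: kron_sum_def)

lemma kron_sum_unitary_conj:
  assumes "unitary_mat n U" "unitary_mat m V" "A \<in> carrier_mat n n" "B \<in> carrier_mat m m"
  shows "kron U V * kron_sum A B * mat_adjoint (kron U V)
    = kron_sum (U * A * mat_adjoint U) (V * B * mat_adjoint V)"
proof -
  note U = unitary_matD[OF assms(1)] and V = unitary_matD[OF assms(2)]
  note c [simp] = kron_carrier[of _ n n _ m m]
  have one: "U * 1\<^sub>m n = U" "V * 1\<^sub>m m = V" using U V by auto
  have "kron U V * kron_sum A B = kron (U * A) V + kron U (V * B)"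
    using assms(3,4) U(1) V(1)
    by (simp add: kron_sum_def mult_add_distrib_mat[of _ "n * m" "n * m" _ "n * m"]
        kron_mult_kron[of _ n n _ n _ m m _ m] one)
  then have "kron U V * kron_sum A B * mat_adjoint (kron U V)
    = (kron (U * A) V + kron U (V * B)) * kron (mat_adjoint U) (mat_adjoint V)"
    by (simp add: mat_adjoint_kron)
  also have "\<dots> = kron (U * A * mat_adjoint U) (V * mat_adjoint V) + kron (U * mat_adjoint U) (V * B * mat_adjoint V)"
    using assms(3,4) U(1,2) V(1,2)
    by (simp add: add_mult_distrib_mat[of _ "n * m" "n * m" _ _ "n * m"]
        kron_mult_kron[of _ n n _ n _ m m _ m])
  also have "\<dots> = kron_sum (U * A * mat_adjoint U) (V * B * mat_adjoint V)"
    using U V by (simp add: kron_sum_def)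
  finally show ?thesis .
qed

text \<open>Blocks of the first factor occupy contiguous index ranges, because
  \<open>x < n * m\<close> holds exactly when \<open>x div m < n\<close>. Blocks of the second
  factor are interleaved; they are reached by exchanging the factors first.\<close>

lemma kron_sum_four_block_diag:
  assumes A: "A \<in> carrier_mat n n" and D: "D \<in> carrier_mat k k" and B: "B \<in> carrier_mat m m"
  shows "kron_sum (four_block_mat A (0\<^sub>m n k) (0\<^sub>m k n) D) B
    = four_block_mat (kron_sum A B) (0\<^sub>m (n * m) (k * m)) (0\<^sub>m (k * m) (n * m)) (kron_sum D B)"
    (is "?L = ?R")
proof (rule eq_matI)
  have c: "kron_sum A B \<in> carrier_mat (n * m) (n * m)" "kron_sum D B \<in> carrier_mat (k * m) (k * m)"
    "four_block_mat A (0\<^sub>m n k) (0\<^sub>m k n) D \<in> carrier_mat (n + k) (n + k)"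
    using A B D by auto
  then show "dim_row ?L = dim_row ?R" "dim_col ?L = dim_col ?R"
    using kron_sum_carrier[OF c(3) B] by (auto simp: algebra_simps)
  fix i j assume "i < dim_row ?R" "j < dim_col ?R"
  then have ij: "i < (n + k) * m" "j < (n + k) * m" using c by (auto simp: algebra_simps)
  note d = div_mod_less[OF ij(1)] div_mod_less[OF ij(2)]
  then have m: "m > 0" by auto
  have lt: "x < n * m \<longleftrightarrow> x div m < n" for x
    using m by (metis div_less_iff_less_mult)
  have sub: "(x - n * m) div m = x div m - n" "(x - n * m) mod m = x mod m" "x - n * m < k * m"
    if "\<not> x div m < n" "x < (n + k) * m" for x
  proof -
    have "n * m \<le> x" using that(1) lt[of x] by simp
    then obtain y where "x = n * m + y" using le_iff_add by auto
    then show "(x - n * m) div m = x div m - n" "(x - n * m) mod m = x mod m" "x - n * m < k * m"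
      using that(2) m by (auto simp: algebra_simps)
  qed
  show "?L $$ (i, j) = ?R $$ (i, j)"
  proof -
    have "?R $$ (i, j) = (if i div m < n
        then if j div m < n then kron_sum A B $$ (i, j) else 0
        else if j div m < n then 0 else kron_sum D B $$ (i - n * m, j - n * m))"
      using c ij lt sub(3) by (subst index_mat_four_block) (auto simp: algebra_simps)
    then show ?thesis
      using A B D c ij d
      by (auto simp: index_kron_sum[OF c(3) B ij] lt sub index_kron_sum[OF A B] index_kron_sum[OF D B])
  qed
qed

text \<open>Permuting rows and columns simultaneously is conjugation by a permutation matrix, which
  is unitary.\<close>

lemma char_poly_gram_permute:
  fixes X :: "complex mat"
  assumes X: "X \<in> carrier_mat n n" and p: "bij_betw p {..<n} {..<n}"
  defines "Y \<equiv> mat n n (\<lambda>(i, j). X $$ (p i, p j))"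
  shows "char_poly (mat_adjoint Y * Y) = char_poly (mat_adjoint X * X)"
proof -
  define P :: "complex mat" where "P = mat n n (\<lambda>(i, j). if j = p i then 1 else 0)"
  have P: "P \<in> carrier_mat n n" by (simp add: P_def)
  have pn: "p i < n" if "i < n" for i using p that by (auto simp: bij_betw_def)
  have inj: "p i = p j \<longleftrightarrow> i = j" if "i < n" "j < n" for i j
    using p that by (auto simp: bij_betw_def inj_on_def)
  have "P * mat_adjoint P = 1\<^sub>m n"
    using P pn inj
    by (intro eq_matI) (auto simp: index_mult_mat_sum P_def if_distrib[of cnj] if_distrib[of "\<lambda>x. x * _"]
        simp del: index_mult_mat(1) cong: if_cong)
  moreover from this have "mat_adjoint P * P = 1\<^sub>m n"
    by (rule mat_mult_left_right_inverse[of P n, rotated -1]) (use P in simp_all)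
  ultimately have "unitary_mat n P" using P by (simp add: unitary_mat_def)
  moreover have "P * X * mat_adjoint P = Y"
  proof (rule eq_matI)
    fix i j assume "i < dim_row Y" "j < dim_col Y"
    then have ij: "i < n" "j < n" by (auto simp: Y_def)
    have PX: "(P * X) $$ (i, k) = X $$ (p i, k)" if "k < n" for k
      using that ij P X pn by (simp add: index_mult_mat_sum P_def if_distrib[of "\<lambda>x. x * _"]
          del: index_mult_mat(1) cong: if_cong)
    have "(P * X * mat_adjoint P) $$ (i, j) = (\<Sum>k<n. (P * X) $$ (i, k) * cnj (P $$ (j, k)))"
      using P X ij by (subst index_mult_mat_sum) (auto simp del: index_mult_mat(1))
    also have "\<dots> = (\<Sum>k<n. if k = p j then X $$ (p i, k) else 0)"
      using ij PX by (intro sum.cong) (auto simp: P_def)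
    also have "\<dots> = Y $$ (i, j)" using ij pn by (simp add: Y_def)
    finally show "(P * X * mat_adjoint P) $$ (i, j) = Y $$ (i, j)" .
  qed (use P X in \<open>auto simp: Y_def\<close>)
  ultimately show ?thesis using char_poly_gram_unitary_conj[of n P X] X by simp
qed

lemma char_poly_gram_kron_sum_commute:
  assumes A: "A \<in> carrier_mat n n" and B: "B \<in> carrier_mat m m"
  shows "char_poly (mat_adjoint (kron_sum A B) * kron_sum A B)
    = char_poly (mat_adjoint (kron_sum B A) * kron_sum B A)"
proof -
  \<comment> \<open>\<open>p\<close> exchanges the two components of an index: the pair encoded in
    base \<open>m\<close> is swapped and encoded again in base \<open>n\<close>.\<close>
  define p where "p i = (i mod m) * n + i div m" for i
  have p: "p i div n = i mod m" "p i mod n = i div m" "p i < m * n" if "i < n * m" for i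
  proof -
    note d = div_mod_less[OF that]
    then show "p i div n = i mod m" "p i mod n = i div m" by (auto simp: p_def)
    have "p i < Suc (i mod m) * n" using d by (simp add: p_def)
    also have "\<dots> \<le> m * n" using d by (intro mult_right_mono) auto
    finally show "p i < m * n" .
  qed
  have "inj_on p {..<n * m}"
    by (rule inj_onI) (metis lessThan_iff p(1,2) div_mult_mod_eq)
  moreover have "p ` {..<n * m} \<subseteq> {..<n * m}" using p(3) by (auto simp: mult.commute)
  ultimately have "bij_betw p {..<n * m} {..<n * m}"
    by (simp add: bij_betw_def endo_inj_surj)
  moreover have "kron_sum A B = mat (n * m) (n * m) (\<lambda>(i, j). kron_sum B A $$ (p i, p j))"
    using kron_sum_carrier[OF A B]
    by (intro eq_matI) (auto simp: index_kron_sum[OF A B] index_kron_sum[OF B A] p)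
  moreover have "kron_sum B A \<in> carrier_mat (n * m) (n * m)"
    using kron_sum_carrier[OF B A] by (simp add: mult.commute)
  ultimately show ?thesis using char_poly_gram_permute by metis
qed

section \<open>Kronecker sums of two-by-two blocks\<close>

lemma sum_lessThan_2: "sum f {..<2 :: nat} = f 0 + (f 1 :: 'a :: comm_monoid_add)"
  by (simp add: numeral_2_eq_2)

lemma fro_norm_power2_2:
  "A \<in> carrier_mat 2 2 \<Longrightarrow> fro_norm A ^ 2
    = (cmod (A $$ (0, 0)))\<^sup>2 + (cmod (A $$ (0, 1)))\<^sup>2 + (cmod (A $$ (1, 0)))\<^sup>2 + (cmod (A $$ (1, 1)))\<^sup>2"
  by (simp add: fro_norm_power2 sum_lessThan_2)

lemma mtrace_2: "A \<in> carrier_mat 2 2 \<Longrightarrow> mtrace A = A $$ (0, 0) + A $$ (1, 1)"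
  by (simp add: mtrace_def sum_lessThan_2)

text \<open>Cauchy-Schwarz against the identity matrix, whose squared norm is 2.\<close>

lemma mtrace_power2_le_2:
  assumes "A \<in> carrier_mat 2 2"
  shows "(cmod (mtrace A))\<^sup>2 \<le> 2 * fro_norm A ^ 2"
proof -
  have "x \<le> 2 * (a + c + d + b)" if "x \<le> 2 * a + 2 * b" "0 \<le> c" "0 \<le> d" for x a b c d :: real
    using that by argo
  from this[OF cmod_add_power2_le zero_le_power2 zero_le_power2] show ?thesis
    unfolding fro_norm_power2_2[OF assms] mtrace_2[OF assms] .
qed

lemma sum_lessThan_4: "sum f {..<4 :: nat} = f 0 + f 1 + f 2 + (f 3 :: 'a :: comm_monoid_add)"
  by (simp add: eval_nat_numeral)

text \<open>With \<open>x\<close> read as the rows of Y, these are the entries \<open>z11\<close>,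
  \<open>z12\<close>, \<open>z21\<close>, \<open>z22\<close> of the two-by-two bounds.\<close>

lemma index_kron_sum_mult_vec_2:
  assumes A: "A \<in> carrier_mat 2 2" and B: "B \<in> carrier_mat 2 2" and x: "x \<in> carrier_vec 4"
  shows
    "(kron_sum A B *\<^sub>v x) $ 0 = A $$ (0, 0) * x $ 0 + A $$ (0, 1) * x $ 2 + B $$ (0, 0) * x $ 0 + B $$ (0, 1) * x $ 1"
    "(kron_sum A B *\<^sub>v x) $ 1 = A $$ (0, 0) * x $ 1 + A $$ (0, 1) * x $ 3 + B $$ (1, 0) * x $ 0 + B $$ (1, 1) * x $ 1"
    "(kron_sum A B *\<^sub>v x) $ 2 = A $$ (1, 0) * x $ 0 + A $$ (1, 1) * x $ 2 + B $$ (0, 0) * x $ 2 + B $$ (0, 1) * x $ 3"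
    "(kron_sum A B *\<^sub>v x) $ 3 = A $$ (1, 0) * x $ 1 + A $$ (1, 1) * x $ 3 + B $$ (1, 0) * x $ 2 + B $$ (1, 1) * x $ 3"
proof -
  have K: "kron_sum A B \<in> carrier_mat 4 4" using kron_sum_carrier[OF A B] by simp
  have "(kron_sum A B *\<^sub>v x) $ i = (\<Sum>k<4. kron_sum A B $$ (i, k) * x $ k)" if "i < 4" for i
    using K x that by (simp add: scalar_prod_def atLeast0LessThan)
  then show
    "(kron_sum A B *\<^sub>v x) $ 0 = A $$ (0, 0) * x $ 0 + A $$ (0, 1) * x $ 2 + B $$ (0, 0) * x $ 0 + B $$ (0, 1) * x $ 1"
    "(kron_sum A B *\<^sub>v x) $ 1 = A $$ (0, 0) * x $ 1 + A $$ (0, 1) * x $ 3 + B $$ (1, 0) * x $ 0 + B $$ (1, 1) * x $ 1"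
    "(kron_sum A B *\<^sub>v x) $ 2 = A $$ (1, 0) * x $ 0 + A $$ (1, 1) * x $ 2 + B $$ (0, 0) * x $ 2 + B $$ (0, 1) * x $ 3"
    "(kron_sum A B *\<^sub>v x) $ 3 = A $$ (1, 0) * x $ 1 + A $$ (1, 1) * x $ 3 + B $$ (1, 0) * x $ 2 + B $$ (1, 1) * x $ 3"
    by (simp_all add: sum_lessThan_4 index_kron_sum[OF A B] algebra_simps)
qed

lemma kron_sum_eigenvalue_le_coarse:
  assumes A: "A \<in> carrier_mat 2 2" and B: "B \<in> carrier_mat 2 2"
    and e: "e \<in># sq_singular_values (kron_sum A B)"
  shows "Re e \<le> 2 * fro_norm A ^ 2 + 2 * fro_norm B ^ 2"
proof (rule gram_eigenvalue_le[OF _ e])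
  show "kron_sum A B \<in> carrier_mat 4 4" using kron_sum_carrier[OF A B] by simp
  fix x :: "complex vec" assume x: "x \<in> carrier_vec 4"
  show "(\<Sum>k<4. (cmod ((kron_sum A B *\<^sub>v x) $ k))\<^sup>2)
      \<le> (2 * fro_norm A ^ 2 + 2 * fro_norm B ^ 2) * (\<Sum>i<4. (cmod (x $ i))\<^sup>2)"
    unfolding sum_lessThan_4 index_kron_sum_mult_vec_2[OF A B x] fro_norm_power2_2[OF A] fro_norm_power2_2[OF B]
    by (rule sylvester_2_coarse_bound)
qed

text \<open>Subtracting half of the squared modulus of the trace from the squared norm leaves that
  of the traceless part. The doubled weight falls on \<open>B\<close>, so this form suits two blocks
  that share \<open>A\<close>.\<close>

lemma kron_sum_eigenvalue_le_weighted:
  assumes A: "A \<in> carrier_mat 2 2" and B: "B \<in> carrier_mat 2 2"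
    and e: "e \<in># sq_singular_values (kron_sum A B)"
  shows "Re e \<le> (cmod (mtrace A + mtrace B))\<^sup>2 + fro_norm A ^ 2 - (cmod (mtrace A))\<^sup>2 / 2
    + 2 * fro_norm B ^ 2 - (cmod (mtrace B))\<^sup>2"
proof (rule gram_eigenvalue_le[OF _ e])
  show "kron_sum A B \<in> carrier_mat 4 4" using kron_sum_carrier[OF A B] by simp
  fix x :: "complex vec" assume x: "x \<in> carrier_vec 4"
  show "(\<Sum>k<4. (cmod ((kron_sum A B *\<^sub>v x) $ k))\<^sup>2)
      \<le> ((cmod (mtrace A + mtrace B))\<^sup>2 + fro_norm A ^ 2 - (cmod (mtrace A))\<^sup>2 / 2
    + 2 * fro_norm B ^ 2 - (cmod (mtrace B))\<^sup>2) * (\<Sum>i<4. (cmod (x $ i))\<^sup>2)"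
    unfolding sum_lessThan_4 index_kron_sum_mult_vec_2[OF A B x] fro_norm_power2_2[OF A] fro_norm_power2_2[OF B]
      mtrace_2[OF A] mtrace_2[OF B] add.assoc[symmetric]
    by (rule sylvester_2_weighted_bound[unfolded add.assoc[symmetric]])
qed

lemma fro_norm_kron_sum_2:
  assumes A: "A \<in> carrier_mat 2 2" and B: "B \<in> carrier_mat 2 2"
  shows "fro_norm (kron_sum A B) ^ 2
    = 2 * fro_norm A ^ 2 + 2 * fro_norm B ^ 2 + 2 * Re (mtrace A * cnj (mtrace B))"
proof -
  have K: "kron_sum A B \<in> carrier_mat 4 4" using kron_sum_carrier[OF A B] by simp
  have add: "(cmod (u + v))\<^sup>2 = (cmod u)\<^sup>2 + (cmod v)\<^sup>2 + 2 * Re (u * cnj v)" for u v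
    unfolding cmod_power2 by (simp add: power2_eq_square algebra_simps)
  have "fro_norm (kron_sum A B) ^ 2 = (\<Sum>i<4. \<Sum>k<4. (cmod (kron_sum A B $$ (k, i)))\<^sup>2)"
    using K by (simp add: fro_norm_power2)
  then show ?thesis unfolding fro_norm_power2_2[OF A] fro_norm_power2_2[OF B] mtrace_2[OF A] mtrace_2[OF B]
    by (simp add: sum_lessThan_4 index_kron_sum[OF A B] add algebra_simps)
qed

section \<open>Combining the four blocks\<close>

lemma proots_kron_sum_block_diag:
  fixes A B :: "bool \<Rightarrow> complex mat"
  assumes A: "\<And>i. A i \<in> carrier_mat 2 2" and B: "\<And>i. B i \<in> carrier_mat 2 2"
  defines "A' \<equiv> four_block_mat (A True) (0\<^sub>m 2 2) (0\<^sub>m 2 2) (A False)"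
    and "B' \<equiv> four_block_mat (B True) (0\<^sub>m 2 2) (0\<^sub>m 2 2) (B False)"
  shows "sq_singular_values (kron_sum A' B') = (\<Sum>i\<in>UNIV. \<Sum>j\<in>UNIV. sq_singular_values (kron_sum (A i) (B j)))"
proof -
  have B': "B' \<in> carrier_mat 4 4" unfolding B'_def using four_block_carrier_mat[OF B[of True] B[of False]] by simp
  have inner: "sq_singular_values (kron_sum (A i) B') = (\<Sum>j\<in>UNIV. sq_singular_values (kron_sum (A i) (B j)))" for i
  proof -
    have "sq_singular_values (kron_sum (A i) B') = sq_singular_values (kron_sum B' (A i))"
      using char_poly_gram_kron_sum_commute[OF A[of i] B'] by simp
    also have "\<dots> = sq_singular_values (kron_sum (B True) (A i)) + sq_singular_values (kron_sum (B False) (A i))"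
      unfolding B'_def kron_sum_four_block_diag[OF B B A]
      by (rule proots_gram_four_block_diag[OF kron_sum_carrier[OF B A] kron_sum_carrier[OF B A]])
    finally show ?thesis
      by (simp add: UNIV_bool char_poly_gram_kron_sum_commute[OF A B] add.commute)
  qed
  have "sq_singular_values (kron_sum A' B')
    = sq_singular_values (kron_sum (A True) B') + sq_singular_values (kron_sum (A False) B')"
    unfolding A'_def kron_sum_four_block_diag[OF A A B']
    by (rule proots_gram_four_block_diag[OF kron_sum_carrier[OF A B'] kron_sum_carrier[OF A B']])
  then show ?thesis by (simp add: inner UNIV_bool add.commute)
qed

lemma pair_subset_sum_mset:
  assumes "finite I" "{#e, f#} \<subseteq># (\<Sum>i\<in>I. R i)"
  shows "(\<exists>i\<in>I. {#e, f#} \<subseteq># R i) \<or> (\<exists>i\<in>I. \<exists>j\<in>I. i \<noteq> j \<and> e \<in># R i \<and> f \<in># R j)"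
proof -
  have "e \<in># (\<Sum>i\<in>I. R i)" using assms(2) by (auto dest: mset_subset_eqD)
  then obtain i where i: "i \<in> I" "e \<in># R i" using assms(1) by (auto simp: set_mset_sum)
  have "(\<Sum>i\<in>I. R i) = R i + (\<Sum>i\<in>I - {i}. R i)" using assms(1) i(1) by (rule sum.remove)
  \<comment> \<open>Removing one copy of \<open>e\<close> before looking for \<open>f\<close> keeps
    the count right when \<open>e = f\<close>.\<close>
  also have "R i = add_mset e (R i - {#e#})" using i(2) by simp
  finally have "add_mset e {#f#} \<subseteq># add_mset e ((R i - {#e#}) + (\<Sum>i\<in>I - {i}. R i))"
    using assms(2) by simp
  then have "f \<in># (R i - {#e#}) + (\<Sum>i\<in>I - {i}. R i)" by simp
  then consider "f \<in># R i - {#e#}" | j where "j \<in> I" "j \<noteq> i" "f \<in># R j"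
    using assms(1) by (auto simp: set_mset_sum)
  then show ?thesis
  proof cases
    case 1
    then have "{#e, f#} \<subseteq># R i"
      using i(2) by (metis insert_DiffM mset_subset_eq_add_mset_cancel single_subset_iff)
    then show ?thesis using i(1) by blast
  next
    case 2
    then show ?thesis using i by (intro disjI2 bexI[of _ i] bexI[of _ j]) auto
  qed
qed

text \<open>With booleans as block indices, negation gives the other block, so two distinct index
  pairs differ in the second, the first or both components.\<close>

lemma kron_sum_block_pair_le:
  fixes A B :: "bool \<Rightarrow> complex mat"
  assumes A: "\<And>i. A i \<in> carrier_mat 2 2" and B: "\<And>i. B i \<in> carrier_mat 2 2"
    and tA: "mtrace (A True) + mtrace (A False) = 0" and tB: "mtrace (B True) + mtrace (B False) = 0"
    and sub: "{#e, f#} \<subseteq># (\<Sum>i\<in>UNIV. \<Sum>j\<in>UNIV. sq_singular_values (kron_sum (A i) (B j)))"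
  shows "Re e + Re f \<le> 2 * (fro_norm (A True) ^ 2 + fro_norm (A False) ^ 2
    + fro_norm (B True) ^ 2 + fro_norm (B False) ^ 2)" (is "_ \<le> 2 * ?S")
proof -
  let ?R = "\<lambda>(i, j). sq_singular_values (kron_sum (A i) (B j))"
  define F where "F M = fro_norm M ^ 2" for M
  define s where "s M = (cmod (mtrace M))\<^sup>2" for M
  have S: "?S = F (A i) + F (A (\<not> i)) + F (B j) + F (B (\<not> j))" for i j
    by (cases i; cases j) (simp_all add: F_def)
  have neg: "mtrace (A (\<not> i)) = - mtrace (A i)" "mtrace (B (\<not> i)) = - mtrace (B i)" for i
    using tA tB by (cases i; simp add: add_eq_0_iff add.commute)+
  then have s: "s (A (\<not> i)) = s (A i)" "s (B (\<not> i)) = s (B i)" for i by (simp_all add: s_def)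
  \<comment> \<open>Opposite traces have equal modulus, so the trace of one block is charged to the
    norm of the other block. This brings in the blocks missing from the bounds on \<open>e\<close>
    and \<open>f\<close>.\<close>
  have sA: "s (A i) \<le> 2 * F (A (\<not> i))" and sB: "s (B i) \<le> 2 * F (B (\<not> i))" for i
    using mtrace_power2_le_2[OF A[of "\<not> i"]] mtrace_power2_le_2[OF B[of "\<not> i"]] s
    by (simp_all add: s_def F_def)
  have par: "(cmod (u + v))\<^sup>2 + (cmod (u - v))\<^sup>2 = 2 * (cmod u)\<^sup>2 + 2 * (cmod v)\<^sup>2" for u v
    unfolding cmod_power2 by (simp add: power2_eq_square algebra_simps)
  have "{#e, f#} \<subseteq># (\<Sum>x\<in>UNIV \<times> UNIV. ?R x)"
    using sub by (simp add: sum.cartesian_product)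
  then have "(\<exists>i j. {#e, f#} \<subseteq># ?R (i, j)) \<or> (\<exists>i j k l. (i, j) \<noteq> (k, l) \<and> e \<in># ?R (i, j) \<and> f \<in># ?R (k, l))"
    using pair_subset_sum_mset[of "UNIV \<times> UNIV" e f ?R] by auto
  then consider (same) i j where "{#e, f#} \<subseteq># ?R (i, j)"
    | (row) i j where "e \<in># ?R (i, j)" "f \<in># ?R (i, \<not> j)"
    | (col) i j where "e \<in># ?R (i, j)" "f \<in># ?R (\<not> i, j)"
    | (diag) i j where "e \<in># ?R (i, j)" "f \<in># ?R (\<not> i, \<not> j)"
  proof (elim disjE exE conjE)
    fix i j k l assume "(i, j) \<noteq> (k, l)" and ef: "e \<in># ?R (i, j)" "f \<in># ?R (k, l)"
    then consider "k = i" "l = (\<not> j)" | "k = (\<not> i)" "l = j" | "k = (\<not> i)" "l = (\<not> j)" by auto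
    then show thesis using ef row col diag by cases blast+
  qed blast
  then show ?thesis
  proof cases
    case same
    have "Re e + Re f \<le> 2 * F (A i) + 2 * F (B j) + 2 * Re (mtrace (A i) * cnj (mtrace (B j)))"
      using gram_eigenvalue_pair_le[OF kron_sum_carrier[OF A B]] same
      unfolding F_def fro_norm_kron_sum_2[OF A B, symmetric] by simp
    then show ?thesis using two_Re_mult_cnj_le[of "mtrace (A i)" "mtrace (B j)"] sA[of i] sB[of j]
      unfolding S[of i j] s_def by argo
  next
    case row
    \<comment> \<open>The second block has trace \<open>- mtrace (B j)\<close>, so the parallelogram
      law adds up the two trace terms. The terms \<open>s (B j)\<close> then cancel, and the one
      remaining \<open>s (A i)\<close> is covered by \<open>sA\<close>.\<close>
    have "Re e \<le> (cmod (mtrace (A i) + mtrace (B j)))\<^sup>2 + F (A i) - s (A i) / 2 + 2 * F (B j) - s (B j)"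
      "Re f \<le> (cmod (mtrace (A i) - mtrace (B j)))\<^sup>2 + F (A i) - s (A i) / 2 + 2 * F (B (\<not> j)) - s (B j)"
      using kron_sum_eigenvalue_le_weighted[OF A B] row s(2)[of j]
      unfolding F_def s_def by (fastforce simp: neg)+
    then show ?thesis using par[of "mtrace (A i)" "mtrace (B j)", folded s_def] sA[of i]
      unfolding S[of i j] by argo
  next
    case col
    \<comment> \<open>Exchanging the factors puts the shared block first and reduces this to the
      argument of the previous case.\<close>
    have "e \<in># sq_singular_values (kron_sum (B j) (A i))" "f \<in># sq_singular_values (kron_sum (B j) (A (\<not> i)))"
      using col by (simp_all add: char_poly_gram_kron_sum_commute[OF B A])
    then have "Re e \<le> (cmod (mtrace (B j) + mtrace (A i)))\<^sup>2 + F (B j) - s (B j) / 2 + 2 * F (A i) - s (A i)"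
      "Re f \<le> (cmod (mtrace (B j) - mtrace (A i)))\<^sup>2 + F (B j) - s (B j) / 2 + 2 * F (A (\<not> i)) - s (A i)"
      using kron_sum_eigenvalue_le_weighted[OF B A] s(1)[of i]
      unfolding F_def s_def by (fastforce simp: neg)+
    then show ?thesis using par[of "mtrace (B j)" "mtrace (A i)", folded s_def] sB[of j]
      unfolding S[of i j] by argo
  next
    case diag
    have "Re e \<le> 2 * F (A i) + 2 * F (B j)" "Re f \<le> 2 * F (A (\<not> i)) + 2 * F (B (\<not> j))"
      using kron_sum_eigenvalue_le_coarse[OF A B] diag unfolding F_def by auto
    then show ?thesis unfolding S[of i j] by argo
  qed
qed

text \<open>Passes from entries of a sorted list to roots with multiplicity, the form in which the
  block bounds apply.\<close>

lemma sigma_1_2_eigenvalues: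
  assumes X: "X \<in> carrier_mat n n" and n: "n \<ge> 2"
  obtains e f where "{#e, f#} \<subseteq># sq_singular_values X"
    "sigma 1 X ^ 2 = Re e" "sigma 2 X ^ 2 = Re f"
proof -
  let ?R = "sq_singular_values X"
  have G: "mat_adjoint X * X \<in> carrier_mat n n" using X by auto
  have ms: "mset (singular_values X) = image_mset (\<lambda>z. sqrt (Re z)) ?R"
    by (simp add: singular_values_def)
  \<comment> \<open>A complex polynomial of degree \<open>n\<close> has \<open>n\<close> roots with
    multiplicity, so the list entries 0 and 1 read by \<open>sigma\<close> exist.\<close>
  have "length (singular_values X) = size (image_mset (\<lambda>z. sqrt (Re z)) ?R)"
    unfolding ms[symmetric] by simp
  also have "\<dots> = n" using degree_monic_char_poly[OF G] by (simp add: size_proots_complex)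
  finally obtain a b l where l: "singular_values X = a # b # l"
    using n by (metis One_nat_def Suc_1 Suc_le_length_iff)
  then have ab: "sigma 1 X = a" "sigma 2 X = b" by (simp_all add: sigma_def)
  obtain e R1 where e: "?R = add_mset e R1" "sqrt (Re e) = a"
      "image_mset (\<lambda>z. sqrt (Re z)) R1 = add_mset b (mset l)"
    using msed_map_invR[of "\<lambda>z. sqrt (Re z)" ?R a "add_mset b (mset l)"] ms l by auto
  \<comment> \<open>\<open>f\<close> is drawn from what remains after removing \<open>e\<close>, so
    both together form a sub-multiset even if they coincide.\<close>
  obtain f R2 where f: "R1 = add_mset f R2" "sqrt (Re f) = b"
    using msed_map_invR[OF e(3)] by auto
  have "Re e \<ge> 0" "Re f \<ge> 0"
    using gram_eigenvalue_nonneg[OF X] e(1) f(1) by auto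
  then have "sigma 1 X ^ 2 = Re e" "sigma 2 X ^ 2 = Re f"
    unfolding ab e(2)[symmetric] f(2)[symmetric] by simp_all
  moreover have "{#e, f#} \<subseteq># ?R" unfolding e(1) f(1) by simp
  ultimately show thesis using that by blast
qed

theorem theorem1:
  fixes A B :: "complex mat"
  assumes A: "A \<in> carrier_mat 4 4" and B: "B \<in> carrier_mat 4 4"
    and trA: "mtrace A = 0" and trB: "mtrace B = 0"
    and norm: "fro_norm A ^ 2 + fro_norm B ^ 2 = 1 / 4"
    and blockA: "\<exists>U A11 A22. unitary_mat 4 U \<and> A11 \<in> carrier_mat 2 2 \<and> A22 \<in> carrier_mat 2 2 \<and>
        U * A * mat_adjoint U = four_block_mat A11 (0\<^sub>m 2 2) (0\<^sub>m 2 2) A22"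
    and blockB: "\<exists>V B11 B22. unitary_mat 4 V \<and> B11 \<in> carrier_mat 2 2 \<and> B22 \<in> carrier_mat 2 2 \<and>
        V * B * mat_adjoint V = four_block_mat B11 (0\<^sub>m 2 2) (0\<^sub>m 2 2) B22"
  shows "sigma 1 (kron A (1\<^sub>m 4) + kron (1\<^sub>m 4) B) ^ 2
       + sigma 2 (kron A (1\<^sub>m 4) + kron (1\<^sub>m 4) B) ^ 2 \<le> 1 / 2"
proof -
  obtain U A11 A22 where U: "unitary_mat 4 U" and A12: "A11 \<in> carrier_mat 2 2" "A22 \<in> carrier_mat 2 2"
    and UA: "U * A * mat_adjoint U = four_block_mat A11 (0\<^sub>m 2 2) (0\<^sub>m 2 2) A22"
    using blockA by blast
  obtain V B11 B22 where V: "unitary_mat 4 V" and B12: "B11 \<in> carrier_mat 2 2" "B22 \<in> carrier_mat 2 2"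
    and VB: "V * B * mat_adjoint V = four_block_mat B11 (0\<^sub>m 2 2) (0\<^sub>m 2 2) B22"
    using blockB by blast
  define a b where "a i = (if i then A11 else A22)" and "b i = (if i then B11 else B22)" for i
  have a: "a i \<in> carrier_mat 2 2" and b: "b i \<in> carrier_mat 2 2" for i
    using A12 B12 by (simp_all add: a_def b_def)
  have X: "kron A (1\<^sub>m 4) + kron (1\<^sub>m 4) B = kron_sum A B"
    using A B by (simp add: kron_sum_def)
  have Xc: "kron_sum A B \<in> carrier_mat (4 * 4) (4 * 4)" using A B by (rule kron_sum_carrier)
  \<comment> \<open>Conjugation by \<open>kron U V\<close>, which is unitary, makes both summands
    block diagonal at once.\<close>
  have "sq_singular_values (kron_sum A B)
    = sq_singular_values (kron U V * kron_sum A B * mat_adjoint (kron U V))"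
    using char_poly_gram_unitary_conj[OF unitary_mat_kron[OF U V] Xc] by simp
  also have "\<dots> = (\<Sum>i\<in>UNIV. \<Sum>j\<in>UNIV. sq_singular_values (kron_sum (a i) (b j)))"
    unfolding kron_sum_unitary_conj[OF U V A B] UA VB
    using proots_kron_sum_block_diag[of a b] a b by (simp add: a_def b_def)
  finally have sv: "sq_singular_values (kron_sum A B) = \<dots>" .
  have fa: "fro_norm A ^ 2 = fro_norm (a True) ^ 2 + fro_norm (a False) ^ 2"
    using fro_norm_unitary_conj[OF U A] fro_norm_four_block_diag[OF A12] by (simp add: UA a_def)
  have fb: "fro_norm B ^ 2 = fro_norm (b True) ^ 2 + fro_norm (b False) ^ 2"
    using fro_norm_unitary_conj[OF V B] fro_norm_four_block_diag[OF B12] by (simp add: VB b_def)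
  have ta: "mtrace (a True) + mtrace (a False) = 0"
    using mtrace_unitary_conj[OF U A] mtrace_four_block_diag[OF A12] trA by (simp add: UA a_def)
  have tb: "mtrace (b True) + mtrace (b False) = 0"
    using mtrace_unitary_conj[OF V B] mtrace_four_block_diag[OF B12] trB by (simp add: VB b_def)
  obtain e f where "{#e, f#} \<subseteq># sq_singular_values (kron_sum A B)"
    "sigma 1 (kron_sum A B) ^ 2 = Re e" "sigma 2 (kron_sum A B) ^ 2 = Re f"
    using sigma_1_2_eigenvalues[OF Xc] by auto
  then show ?thesis
    using kron_sum_block_pair_le[of a b e f, OF a b ta tb] norm unfolding X sv fa fb by simp
qed

end
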